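(* Let $\Gamma$ be a finite tetravalent half-arc-transitive graph, with radius $r=\mathrm{rad}(\Gamma)$ and attachment number $a=\mathrm{att}(\Gamma)$. If $r$ is odd, then $a$ divides $r$. Consequently, if $a$ is not divisible by $4$, then $a$ divides $r$.
   Context: All graphs are finite and simple. For a tetravalent graph $\Gamma$ and $G\le \mathrm{Aut}(\Gamma)$, $\Gamma$ is $G$-half-arc-transitive if $G$ acts transitively on the vertices and on the edges but not on the arcs of $\Gamma$; $\Gamma$ is half-arc-transitive if it is $\mathrm{Aut}(\Gamma)$-half-arc-transitive. In that case the $G$-orbits on arcs give two paired orientations of the edges (choose one; write $u\to v$), and each vertex is the tail of two and the head of two of its incident edges. A $G$-alternating cycle is a cycle of $\Gamma$ in which every two consecutive edges have either a common head or a common tail. All $G$-alternating cycles have the same even length $2\,\mathrm{rad}_G(\Gamma)$ ($\mathrm{rad}_G(\Gamma)$ is the $G$-radius), and any two $G$-alternating cycles sharing a vertex meet in the same number $\mathrm{att}_G(\Gamma)$ of vertices (the $G$-attachment number). $\mathrm{rad}(\Gamma)$ and $\mathrm{att}(\Gamma)$ denote these parameters for $G=\mathrm{Aut}(\Gamma)$. *)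

theory Defs
  imports Main
begin

definition simple_graph :: "'a set \<Rightarrow> ('a \<Rightarrow> 'a \<Rightarrow> bool) \<Rightarrow> bool" where
  "simple_graph V E \<longleftrightarrow> finite V \<and> (\<forall>u v. E u v \<longrightarrow> u \<in> V \<and> v \<in> V)
     \<and> (\<forall>u v. E u v \<longrightarrow> E v u) \<and> (\<forall>u. \<not> E u u)"

definition tetravalent :: "'a set \<Rightarrow> ('a \<Rightarrow> 'a \<Rightarrow> bool) \<Rightarrow> bool" where
  "tetravalent V E \<longleftrightarrow> (\<forall>v\<in>V. card {u\<in>V. E v u} = 4)"

definition aut :: "'a set \<Rightarrow> ('a \<Rightarrow> 'a \<Rightarrow> bool) \<Rightarrow> ('a \<Rightarrow> 'a) set" where
  "aut V E = {g. bij_betw g V V \<and> (\<forall>u\<in>V. \<forall>v\<in>V. E u v \<longleftrightarrow> E (g u) (g v))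
               \<and> (\<forall>x. x \<notin> V \<longrightarrow> g x = x)}"

definition vertex_transitive_on :: "'a set \<Rightarrow> ('a \<Rightarrow> 'a) set \<Rightarrow> bool" where
  "vertex_transitive_on V G \<longleftrightarrow> (\<forall>u\<in>V. \<forall>v\<in>V. \<exists>g\<in>G. g u = v)"

definition edge_transitive_on :: "('a \<Rightarrow> 'a \<Rightarrow> bool) \<Rightarrow> ('a \<Rightarrow> 'a) set \<Rightarrow> bool" where
  "edge_transitive_on E G \<longleftrightarrow>
     (\<forall>u v x y. E u v \<longrightarrow> E x y \<longrightarrow> (\<exists>g\<in>G. {g u, g v} = {x, y}))"

definition arc_transitive_on :: "('a \<Rightarrow> 'a \<Rightarrow> bool) \<Rightarrow> ('a \<Rightarrow> 'a) set \<Rightarrow> bool" where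
  "arc_transitive_on E G \<longleftrightarrow>
     (\<forall>u v x y. E u v \<longrightarrow> E x y \<longrightarrow> (\<exists>g\<in>G. g u = x \<and> g v = y))"

definition G_half_arc_transitive ::
  "'a set \<Rightarrow> ('a \<Rightarrow> 'a \<Rightarrow> bool) \<Rightarrow> ('a \<Rightarrow> 'a) set \<Rightarrow> bool" where
  "G_half_arc_transitive V E G \<longleftrightarrow> simple_graph V E \<and> tetravalent V E \<and> G \<subseteq> aut V E
     \<and> vertex_transitive_on V G \<and> edge_transitive_on E G \<and> \<not> arc_transitive_on E G"

definition half_arc_transitive :: "'a set \<Rightarrow> ('a \<Rightarrow> 'a \<Rightarrow> bool) \<Rightarrow> bool" where
  "half_arc_transitive V E \<longleftrightarrow> G_half_arc_transitive V E (aut V E)"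

definition orient :: "('a \<Rightarrow> 'a \<Rightarrow> bool) \<Rightarrow> ('a \<Rightarrow> 'a) set \<Rightarrow> 'a \<Rightarrow> 'a \<Rightarrow> bool" where
  "orient E G u v \<longleftrightarrow>
     (let a = (SOME p. E (fst p) (snd p)) in (u, v) \<in> (\<lambda>g. (g (fst a), g (snd a))) ` G)"

definition is_cycle :: "('a \<Rightarrow> 'a \<Rightarrow> bool) \<Rightarrow> 'a list \<Rightarrow> bool" where
  "is_cycle E c \<longleftrightarrow> distinct c \<and> length c \<ge> 3
     \<and> (\<forall>i < length c. E (c ! i) (c ! ((i + 1) mod length c)))"

definition alternating_cycle ::
  "('a \<Rightarrow> 'a \<Rightarrow> bool) \<Rightarrow> ('a \<Rightarrow> 'a) set \<Rightarrow> 'a list \<Rightarrow> bool" where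
  "alternating_cycle E G c \<longleftrightarrow> is_cycle E c \<and>
     (\<forall>i < length c.
        let n = length c; p = c ! ((i + n - 1) mod n); x = c ! i; q = c ! ((i + 1) mod n) in
        (orient E G p x \<and> orient E G q x) \<or> (orient E G x p \<and> orient E G x q))"

definition cycle_edges :: "'a list \<Rightarrow> 'a set set" where
  "cycle_edges c = {{c ! i, c ! ((i + 1) mod length c)} | i. i < length c}"

text \<open>G-radius: half the (common) length of the G-alternating cycles.\<close>
definition G_radius :: "('a \<Rightarrow> 'a \<Rightarrow> bool) \<Rightarrow> ('a \<Rightarrow> 'a) set \<Rightarrow> nat" where
  "G_radius E G = length (SOME c. alternating_cycle E G c) div 2"

text \<open>G-attachment number: number of common vertices of two distinct G-alternating cycles
  sharing a vertex (the same for all such pairs).\<close>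
definition G_attachment :: "('a \<Rightarrow> 'a \<Rightarrow> bool) \<Rightarrow> ('a \<Rightarrow> 'a) set \<Rightarrow> nat" where
  "G_attachment E G =
     (let cc = (SOME cc. alternating_cycle E G (fst cc) \<and> alternating_cycle E G (snd cc)
                 \<and> cycle_edges (fst cc) \<noteq> cycle_edges (snd cc)
                 \<and> set (fst cc) \<inter> set (snd cc) \<noteq> {})
      in card (set (fst cc) \<inter> set (snd cc)))"

definition rad :: "'a set \<Rightarrow> ('a \<Rightarrow> 'a \<Rightarrow> bool) \<Rightarrow> nat" where
  "rad V E = G_radius E (aut V E)"

definition att :: "'a set \<Rightarrow> ('a \<Rightarrow> 'a \<Rightarrow> bool) \<Rightarrow> nat" where
  "att V E = G_attachment E (aut V E)"

end

theory Submission
  imports Defs "HOL-Combinatorics.Cycles"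
begin

text \<open>
  Parametrise an alternating cycle by the integers modulo \<open>2r\<close>, with tails at even and heads at
  odd positions. Arc-transitivity on the orientation makes all even rotations and all reflections
  at vertices of the cycle come from automorphisms; hence the positions lying on a second
  alternating cycle through position \<open>0\<close> form a subgroup of order \<open>a\<close>, and \<open>a\<close> divides \<open>2r\<close>.
  If \<open>a\<close> is even, this subgroup contains \<open>r\<close>, so the antipode of a vertex on one of its cycles
  lies on both of them and, by a reflection, is its antipode on both. The resulting antipodal map
  is an automorphism of the graph. If moreover \<open>r\<close> is odd, it interchanges tails and heads, so it
  reverses the orientation, which contradicts half-arc-transitivity. Thus \<open>r\<close> is even
  whenever \<open>a\<close> is, and both claims follow.
\<close>

section \<open>Subgroups of the integers and their images modulo a period\<close>

text \<open>Closure under differences makes \<open>S\<close> a subgroup. Its least positive element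
  generates it, because remainders modulo that element stay in \<open>S\<close> and are
  smaller.\<close>

lemma int_subgroup_multiples:
  fixes S :: "int set"
  assumes diff: "\<And>i j. i \<in> S \<Longrightarrow> j \<in> S \<Longrightarrow> i - j \<in> S" and "p \<in> S" "p > 0"
  obtains l where "l > 0" "S = {i. l dvd i}"
proof -
  define l where "l = (LEAST k::nat. k > 0 \<and> int k \<in> S)"
  have "nat p > 0 \<and> int (nat p) \<in> S" using assms by simp
  then have l: "l > 0 \<and> int l \<in> S"
    unfolding l_def by (rule LeastI[where P = "\<lambda>k. k > 0 \<and> int k \<in> S"])
  have least: "l \<le> k" if "k > 0" "int k \<in> S" for k
    unfolding l_def by (rule Least_le) (use that in simp)
  have zero: "0 \<in> S" using diff[OF \<open>p \<in> S\<close> \<open>p \<in> S\<close>] by simp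
  have minus: "- i \<in> S" if "i \<in> S" for i using diff[OF zero that] by simp
  have add: "i + j \<in> S" if "i \<in> S" "j \<in> S" for i j
    using diff[OF that(1) minus[OF that(2)]] by simp
  have mult_nat: "int l * int k \<in> S" for k
    by (induction k) (use zero add l in \<open>auto simp: algebra_simps\<close>)
  have mult: "int l * k \<in> S" for k
    by (cases k rule: int_cases2) (use mult_nat minus in auto)
  have "int l dvd i" if "i \<in> S" for i
  proof -
    have "i - int l * (i div int l) \<in> S" by (rule diff[OF that mult])
    then have "int (nat (i mod int l)) \<in> S" using l by (simp add: minus_mult_div_eq_mod)
    then have "i mod int l = 0"
      using least[of "nat (i mod int l)"] l pos_mod_bound[of "int l" i] pos_mod_sign[of "int l" i]
      by linarith
    then show ?thesis by auto
  qed
  then have "S = {i. int l dvd i}" using mult by (auto elim: dvdE)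
  then show thesis using that[of "int l"] l by simp
qed

text \<open>\<open>f\<close> amounts to an injective map on the integers modulo \<open>m\<close>,
  where the multiples of \<open>l\<close> have the representatives \<open>l * k\<close> with
  \<open>0 \<le> k < m div l\<close>.\<close>

lemma card_image_multiples:
  fixes f :: "int \<Rightarrow> 'b" and l m :: int
  assumes per: "\<And>i j. f i = f j \<longleftrightarrow> m dvd i - j" and "m > 0" "l > 0" "l dvd m"
  shows "card (f ` {i. l dvd i}) = nat (m div l)"
proof -
  obtain q where q: "m = l * q" using assms by auto
  have qpos: "q > 0" using q assms by (simp add: zero_less_mult_iff)
  have "f ` {i. l dvd i} = (\<lambda>k. f (l * k)) ` {0..<q}"
  proof
    show "f ` {i. l dvd i} \<subseteq> (\<lambda>k. f (l * k)) ` {0..<q}"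
    proof
      fix x assume "x \<in> f ` {i. l dvd i}"
      then obtain k where k: "x = f (l * k)" by auto
      have "f (l * k) = f (l * (k mod q))"
        unfolding per q by (simp flip: right_diff_distrib add: \<open>l > 0\<close> mod_eq_dvd_iff[symmetric])
      then show "x \<in> (\<lambda>k. f (l * k)) ` {0..<q}" using k qpos by auto
    qed
  qed auto
  moreover have "inj_on (\<lambda>k. f (l * k)) {0..<q}"
  proof (rule inj_onI)
    fix x y assume xy: "x \<in> {0..<q}" "y \<in> {0..<q}" "f (l * x) = f (l * y)"
    then have "q dvd x - y" using \<open>l > 0\<close> by (simp add: per q flip: right_diff_distrib)
    then have "x mod q = y mod q" by (simp add: mod_eq_dvd_iff)
    then show "x = y" using xy by simp
  qed
  ultimately show ?thesis using q \<open>l > 0\<close> by (simp add: card_image)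
qed

lemma card_2_pair: "card A = 2 \<Longrightarrow> x \<in> A \<Longrightarrow> y \<in> A \<Longrightarrow> x \<noteq> y \<Longrightarrow> A = {x, y}"
  by (auto simp: card_2_iff)

section \<open>Cyclic lists as periodic maps on the integers\<close>

text \<open>Insensitive to starting point and direction, hence suited to telling alternating cycles
  apart.\<close>

definition walk_edges :: "(int \<Rightarrow> 'a) \<Rightarrow> 'a set set" where
  "walk_edges f = range (\<lambda>i. {f i, f (i + 1)})"

lemma walk_edges_shift: "walk_edges (\<lambda>x. f (x + s)) = walk_edges f"
proof -
  have "surj (\<lambda>x::int. x + s)" by (rule surjI[where f = "\<lambda>x. x - s"]) simp
  then have "range ((\<lambda>i. {f i, f (i + 1)}) \<circ> (\<lambda>x. x + s)) = walk_edges f"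
    unfolding walk_edges_def image_comp[symmetric] by simp
  then show ?thesis by (simp add: walk_edges_def o_def algebra_simps)
qed

lemma walk_edges_reflect: "walk_edges (\<lambda>x. f (s - x)) = walk_edges f"
proof -
  have "surj (\<lambda>x::int. s - x - 1)" by (rule surjI[where f = "\<lambda>x. s - x - 1"]) simp
  then have "range ((\<lambda>i. {f i, f (i + 1)}) \<circ> (\<lambda>x. s - x - 1)) = walk_edges f"
    unfolding walk_edges_def image_comp[symmetric] by simp
  then show ?thesis by (simp add: walk_edges_def o_def insert_commute diff_diff_eq)
qed

text \<open>Periodic extension to all integers: neighbours on the cycle are at \<open>i - 1\<close>
  and \<open>i + 1\<close>, without reduction modulo the length.\<close>

definition cyclic_nth :: "'a list \<Rightarrow> int \<Rightarrow> 'a" where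
  "cyclic_nth c i = c ! nat (i mod int (length c))"

lemma cyclic_nth_int: "cyclic_nth c (int i) = c ! (i mod length c)"
  by (simp add: cyclic_nth_def nat_mod_distrib)

lemma cyclic_nth_prev:
  assumes "i < length c" shows "cyclic_nth c (int i - 1) = c ! ((i + length c - 1) mod length c)"
proof -
  have "int (i + length c - 1) = int i - 1 + int (length c)" using assms by auto
  then have "int (i + length c - 1) mod int (length c) = (int i - 1) mod int (length c)" by simp
  then show ?thesis unfolding cyclic_nth_int[symmetric] cyclic_nth_def by simp
qed

lemma cyclic_nth_all:
  assumes "c \<noteq> []"
  shows "(\<forall>i. P (cyclic_nth c (i - 1)) (cyclic_nth c i) (cyclic_nth c (i + 1))) \<longleftrightarrow>
    (\<forall>i < length c. P (c ! ((i + length c - 1) mod length c)) (c ! i) (c ! ((i + 1) mod length c)))"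
    (is "?L \<longleftrightarrow> ?R")
proof -
  have nat: "cyclic_nth c (int i - 1) = c ! ((i + length c - 1) mod length c)"
    "cyclic_nth c (int i) = c ! i" "cyclic_nth c (int i + 1) = c ! ((i + 1) mod length c)"
    if "i < length c" for i
    using cyclic_nth_prev[OF that] cyclic_nth_int[of c i] cyclic_nth_int[of c "i + 1"] that
    by (simp_all add: add.commute)
  show ?thesis
  proof
    assume L: ?L
    show ?R
    proof (intro allI impI)
      fix i assume "i < length c"
      then show "P (c ! ((i + length c - 1) mod length c)) (c ! i) (c ! ((i + 1) mod length c))"
        using L[rule_format, of "int i"] nat by simp
    qed
  next
    assume R: ?R
    show ?L
    proof
      fix i :: int
      define k where "k = nat (i mod int (length c))"
      have k: "k < length c" "int k = i mod int (length c)" using assms by (auto simp: k_def nat_less_iff)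
      have "cyclic_nth c (int k + s) = cyclic_nth c (i + s)" for s
        unfolding cyclic_nth_def k(2) by (simp add: mod_simps)
      from this[of "-1"] this[of 0] this[of 1] R[rule_format, OF k(1)] nat[OF k(1)]
      show "P (cyclic_nth c (i - 1)) (cyclic_nth c i) (cyclic_nth c (i + 1))" by simp
    qed
  qed
qed

lemma alternating_cycle_iff:
  "alternating_cycle E G c \<longleftrightarrow> distinct c \<and> length c \<ge> 3 \<and>
     (\<forall>i. E (cyclic_nth c i) (cyclic_nth c (i + 1))) \<and>
     (\<forall>i. (orient E G (cyclic_nth c (i - 1)) (cyclic_nth c i) \<and>
             orient E G (cyclic_nth c (i + 1)) (cyclic_nth c i)) \<or>
           (orient E G (cyclic_nth c i) (cyclic_nth c (i - 1)) \<and>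
             orient E G (cyclic_nth c i) (cyclic_nth c (i + 1))))"
proof (cases "c = []")
  case False
  show ?thesis
    unfolding alternating_cycle_def is_cycle_def Let_def
      cyclic_nth_all[OF False, where P = "\<lambda>p x q. E x q"]
      cyclic_nth_all[OF False, where P = "\<lambda>p x q. (orient E G p x \<and> orient E G q x) \<or>
        (orient E G x p \<and> orient E G x q)"]
    by blast
qed (simp add: alternating_cycle_def is_cycle_def)

lemma cyclic_nth_eq_iff:
  assumes "distinct c" "c \<noteq> []"
  shows "cyclic_nth c i = cyclic_nth c j \<longleftrightarrow> int (length c) dvd i - j"
  using assms by (simp add: cyclic_nth_def nth_eq_iff_index_eq nat_less_iff eq_nat_nat_iff mod_eq_dvd_iff)

lemma range_cyclic_nth: assumes "c \<noteq> []" shows "range (cyclic_nth c) = set c"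
proof
  show "range (cyclic_nth c) \<subseteq> set c" using assms by (auto simp: cyclic_nth_def nat_less_iff)
  show "set c \<subseteq> range (cyclic_nth c)"
  proof
    fix x assume "x \<in> set c"
    then obtain i where "i < length c" "x = c ! i" by (auto simp: in_set_conv_nth)
    then have "x = cyclic_nth c (int i)" by (simp add: cyclic_nth_int)
    then show "x \<in> range (cyclic_nth c)" by simp
  qed
qed

lemma walk_edges_cyclic_nth:
  assumes "c \<noteq> []" shows "walk_edges (cyclic_nth c) = cycle_edges c"
proof -
  have "walk_edges (cyclic_nth c) \<subseteq> cycle_edges c"
    using cyclic_nth_all[OF assms, of "\<lambda>p x q. {x, q} \<in> cycle_edges c"]
    by (auto simp: walk_edges_def cycle_edges_def)
  moreover have "cycle_edges c \<subseteq> walk_edges (cyclic_nth c)"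
    using cyclic_nth_all[OF assms, of "\<lambda>p x q. {x, q} \<in> walk_edges (cyclic_nth c)"]
    by (auto simp: walk_edges_def cycle_edges_def)
  ultimately show ?thesis by blast
qed

section \<open>Alternating walks in arc-transitive digraphs of in- and out-valency two\<close>

locale arc_transitive_digraph =
  fixes V :: "'a set" and D :: "'a \<Rightarrow> 'a \<Rightarrow> bool" and G :: "('a \<Rightarrow> 'a) set"
  assumes finite_V: "finite V"
    and D_V: "D u v \<Longrightarrow> u \<in> V \<and> v \<in> V"
    and D_asym: "D u v \<Longrightarrow> \<not> D v u"
    and card_out: "v \<in> V \<Longrightarrow> card {w. D v w} = 2"
    and card_in: "v \<in> V \<Longrightarrow> card {w. D w v} = 2"
    and G_permutes: "g \<in> G \<Longrightarrow> g permutes V"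
    and G_D: "g \<in> G \<Longrightarrow> D u v \<Longrightarrow> D (g u) (g v)"
    and G_trans: "D u v \<Longrightarrow> D x y \<Longrightarrow> \<exists>g\<in>G. g u = x \<and> g v = y"
begin

text \<open>An alternating cycle unrolled over the integers, tails at even positions. Every edge has
  one even end, so the conditions there orient all edges; the last clause excludes turning
  back.\<close>

definition alt_walk :: "(int \<Rightarrow> 'a) \<Rightarrow> bool" where
  "alt_walk f \<longleftrightarrow> (\<forall>i. even i \<longrightarrow> D (f i) (f (i + 1)) \<and> D (f i) (f (i - 1)))
     \<and> (\<forall>i. f (i + 1) \<noteq> f (i - 1))"

lemma alt_walk_neq: "alt_walk f \<Longrightarrow> f (i + 1) \<noteq> f (i - 1)"
  by (simp add: alt_walk_def)

lemma alt_walk_even: "alt_walk f \<Longrightarrow> even i \<Longrightarrow> D (f i) (f (i + 1)) \<and> D (f i) (f (i - 1))"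
  by (simp add: alt_walk_def)

lemma alt_walk_odd: "alt_walk f \<Longrightarrow> odd i \<Longrightarrow> D (f (i + 1)) (f i) \<and> D (f (i - 1)) (f i)"
  using alt_walk_even[of f "i + 1"] alt_walk_even[of f "i - 1"] by simp

lemma alt_walk_in_V: "alt_walk f \<Longrightarrow> f i \<in> V"
  using alt_walk_even[of f i] alt_walk_odd[of f i] D_V by blast

lemma alt_walk_shift:
  assumes f: "alt_walk f" and s: "even s" shows "alt_walk (\<lambda>i. f (i + s))"
proof -
  have e: "i + 1 + s = (i + s) + 1" "i - 1 + s = (i + s) - 1" for i by auto
  show ?thesis unfolding alt_walk_def e
    by (simp add: alt_walk_even[OF f] alt_walk_neq[OF f] s)
qed

lemma alt_walk_reflect:
  assumes f: "alt_walk f" and s: "even s" shows "alt_walk (\<lambda>i. f (s - i))"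
proof -
  have e: "s - (i + 1) = (s - i) - 1" "s - (i - 1) = (s - i) + 1" for i by auto
  show ?thesis unfolding alt_walk_def e
    by (simp add: alt_walk_even[OF f] alt_walk_neq[OF f, symmetric] s)
qed

lemma alt_walk_G:
  assumes "alt_walk f" "g \<in> G" shows "alt_walk (\<lambda>i. g (f i))"
  using assms G_D permutes_inj[OF G_permutes[OF \<open>g \<in> G\<close>]]
  unfolding alt_walk_def by (auto dest: injD)

lemma alt_walk_nbrs_even:
  assumes "alt_walk f" "even i" shows "{w. D (f i) w} = {f (i + 1), f (i - 1)}"
  using alt_walk_even[OF assms] alt_walk_neq[OF assms(1)] card_out[OF alt_walk_in_V[OF assms(1)]]
  by (intro card_2_pair) auto

lemma alt_walk_nbrs_odd:
  assumes "alt_walk f" "odd i" shows "{w. D w (f i)} = {f (i + 1), f (i - 1)}"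
  using alt_walk_odd[OF assms] alt_walk_neq[OF assms(1)] card_in[OF alt_walk_in_V[OF assms(1)]]
  by (intro card_2_pair) auto

lemma alt_walk_nbrs_eq:
  assumes "alt_walk f" "alt_walk h" "f i = h i"
  shows "{f (i + 1), f (i - 1)} = {h (i + 1), h (i - 1)}"
  using assms alt_walk_nbrs_even[of _ i] alt_walk_nbrs_odd[of _ i] by (cases "even i") metis+

text \<open>A vertex has just two neighbours on the relevant side, so two consecutive values force
  the next one in either direction.\<close>

lemma alt_walk_unique:
  assumes f: "alt_walk f" and h: "alt_walk h" and "f j = h j" "f (j + 1) = h (j + 1)"
  shows "f = h"
proof
  fix x
  have "f x = h x \<and> f (x + 1) = h (x + 1)"
  proof (induction x rule: int_induct[where k = j])
    case base then show ?case using assms by simp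
  next
    case (step1 i)
    then show ?case
      using alt_walk_nbrs_eq[OF f h, of "i + 1"] alt_walk_neq[OF f, of "i + 1"]
        alt_walk_neq[OF h, of "i + 1"] by (auto simp: doubleton_eq_iff)
  next
    case (step2 i)
    then show ?case
      using alt_walk_nbrs_eq[OF f h, of i] alt_walk_neq[OF f, of i]
        alt_walk_neq[OF h, of i] by (auto simp: doubleton_eq_iff)
  qed
  then show "f x = h x" by simp
qed

text \<open>An element of \<open>G\<close> matching the arcs at positions 0 and 1 matches the entire
  walks by uniqueness. Applied to shifts and reflections of one walk, this realises its even
  rotations and its reflections at vertices in \<open>G\<close>.\<close>

lemma alt_walk_transitive:
  assumes f: "alt_walk f" and h: "alt_walk h"
  obtains g where "g \<in> G" "\<And>i. g (f i) = h i"
proof -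
  obtain g where g: "g \<in> G" "g (f 0) = h 0" "g (f 1) = h 1"
    using G_trans[of "f 0" "f 1" "h 0" "h 1"] alt_walk_even[OF f, of 0] alt_walk_even[OF h, of 0]
    by auto
  then have "(\<lambda>i. g (f i)) = h"
    using alt_walk_unique[OF alt_walk_G[OF f g(1)] h, of 0] by simp
  then show thesis using that g(1) by metis
qed

text \<open>A vertex is left (or entered) by only two arcs, so an alternating walk through it is
  determined up to direction.\<close>

lemma alt_walk_meet:
  assumes f: "alt_walk f" and h: "alt_walk h" and eq: "f i = h j" and par: "even (i - j)"
  shows "(\<forall>x. h x = f (x + (i - j))) \<or> (\<forall>x. h x = f (i + j - x))"
proof -
  define f1 where "f1 = (\<lambda>x. f (x + (i - j)))"
  define f2 where "f2 = (\<lambda>x. f (i + j - x))"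
  have f1: "alt_walk f1" unfolding f1_def by (rule alt_walk_shift[OF f par])
  have f2: "alt_walk f2" unfolding f2_def by (rule alt_walk_reflect[OF f]) (use par in presburger)
  have at_j: "f1 j = h j" "f2 j = h j" using eq by (simp_all add: f1_def f2_def)
  have swap: "f1 (j - 1) = f2 (j + 1)" by (simp add: f1_def f2_def algebra_simps)
  have "h (j + 1) = f1 (j + 1) \<or> h (j + 1) = f2 (j + 1)"
    using alt_walk_nbrs_eq[OF f1 h at_j(1)] swap by (auto simp: doubleton_eq_iff)
  then have "f1 = h \<or> f2 = h"
    using alt_walk_unique[OF f1 h at_j(1)] alt_walk_unique[OF f2 h at_j(2)] by metis
  then show ?thesis by (auto simp: f1_def f2_def)
qed

lemma alt_walk_meet_range:
  assumes "alt_walk f" "alt_walk h" "f i = h j" "even (i - j)"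
  shows "range f = range h"
proof -
  have "surj (\<lambda>x. x + (i - j))" "surj (\<lambda>x. i + j - x)"
    by (rule surjI[where f = "\<lambda>x. x - (i - j)"], simp) (rule surjI[where f = "\<lambda>x. i + j - x"], simp)
  then have "range (f \<circ> (\<lambda>x. x + (i - j))) = range f" "range (f \<circ> (\<lambda>x. i + j - x)) = range f"
    by (simp_all only: image_comp[symmetric])
  moreover have "h = f \<circ> (\<lambda>x. x + (i - j)) \<or> h = f \<circ> (\<lambda>x. i + j - x)"
    using alt_walk_meet[OF assms] by (auto simp: fun_eq_iff)
  ultimately show ?thesis by auto
qed

text \<open>With centre \<open>t\<close>, where \<open>s = 2 * t\<close>, the reflection would
  identify the two distinct neighbours \<open>f (t + 1)\<close> and
  \<open>f (t - 1)\<close>.\<close>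

lemma alt_walk_no_reflection: "alt_walk f \<Longrightarrow> even s \<Longrightarrow> \<not> (\<forall>x. f x = f (s - x))"
proof
  assume f: "alt_walk f" "even s" and r: "\<forall>x. f x = f (s - x)"
  obtain t where "s = 2 * t" using f by auto
  then show False using alt_walk_neq[OF f(1), of t] r[rule_format, of "t + 1"] by (simp add: algebra_simps)
qed

text \<open>A walk that revisits a vertex at positions of opposite parity would, by the symmetry of
  the walk under reflections and even rotations, be periodic with an odd period, and some arc
  would be oriented both ways.\<close>

lemma alt_walk_parity:
  assumes f: "alt_walk f" and eq: "f i = f j" shows "even (i - j)"
proof (rule ccontr)
  assume odd: "odd (i - j)"
  define k where "k = j - i"
  have k: "odd k" "f (i + k) = f i" using odd eq by (auto simp: k_def)
  obtain g where g: "g \<in> G" "\<And>x. g (f x) = f (2 * i - x)"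
    using alt_walk_transitive[OF f alt_walk_reflect[OF f, of "2 * i"]] by auto
  \<comment> \<open>The reflection about \<open>i\<close> fixes the vertex
    \<open>f i = f (i + k)\<close> and moves position \<open>i + k\<close> to
    \<open>i - k\<close>.\<close>
  have "f (i - k) = f (i + k)"
    using g(2)[of i] g(2)[of "i + k"] k by simp
  then have "(\<forall>x. f x = f (x + (i + k - (i - k)))) \<or> (\<forall>x. f x = f (i + k + (i - k) - x))"
    by (intro alt_walk_meet[OF f f]) auto
  moreover have "\<not> (\<forall>x. f x = f (i + k + (i - k) - x))"
    by (rule alt_walk_no_reflection[OF f]) simp
  ultimately have "f x = f (x + (i + k - (i - k)))" for x by blast
  moreover have "i + k - (i - k) = 2 * k" by simp
  ultimately have per2: "f (x + 2 * k) = f x" for x by metis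
  have per1: "f (x + k) = f x" if "even (x - i)" for x
  proof -
    obtain g where g: "g \<in> G" "\<And>y. g (f y) = f (y + (x - i))"
      using alt_walk_transitive[OF f alt_walk_shift[OF f \<open>even (x - i)\<close>]] by auto
    show ?thesis using g(2)[of i] g(2)[of "i + k"] k by (simp add: algebra_simps)
  qed
  have per: "f (x + k) = f x" for x
  proof (cases "even (x - i)")
    case False
    then have "f (x + k + k) = f (x + k)" using k by (intro per1) presburger
    then show ?thesis using per2[of x] by (simp add: algebra_simps)
  qed (rule per1)
  have "D (f (k + 1)) (f k)" using alt_walk_odd[OF f k(1)] by simp
  then have "D (f 1) (f 0)" using per[of 0] per[of 1] by (simp add: add.commute)
  then show False using alt_walk_even[OF f, of 0] D_asym by auto
qed

lemma alt_walk_eq_shift: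
  assumes f: "alt_walk f" and eq: "f i = f j" shows "f (x + (i - j)) = f x"
proof -
  have par: "even (i - j)" by (rule alt_walk_parity[OF f eq])
  then have "\<not> (\<forall>x. f x = f (i + j - x))"
    by (intro alt_walk_no_reflection[OF f]) presburger
  then show ?thesis using alt_walk_meet[OF f f eq par] by metis
qed

text \<open>The periods form a subgroup of the integers, nonzero by finiteness of \<open>V\<close>,
  and its generator is the number of vertices. So no vertex repeats within one period.\<close>

lemma alt_walk_eq_iff:
  assumes f: "alt_walk f"
  shows "f i = f j \<longleftrightarrow> int (card (range f)) dvd i - j"
proof -
  define S where "S = {s. \<forall>x. f (x + s) = f x}"
  have diff: "s - t \<in> S" if "s \<in> S" "t \<in> S" for s t
  proof -
    have "f (x + (s - t)) = f x" for x
    proof -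
      have "f (x - t + s) = f (x - t)" "f (x - t + t) = f (x - t)"
        using that unfolding S_def by blast+
      then show ?thesis by (simp add: algebra_simps)
    qed
    then show ?thesis by (simp add: S_def)
  qed
  have S_iff: "f i = f j \<longleftrightarrow> i - j \<in> S" for i j
  proof
    assume "i - j \<in> S"
    then have "f (j + (i - j)) = f j" unfolding S_def by blast
    then show "f i = f j" by simp
  qed (simp add: S_def alt_walk_eq_shift[OF f])
  have "\<not> inj f"
    using finite_subset[OF _ finite_V, of "range f"] alt_walk_in_V[OF f] finite_imageD[of f UNIV]
    by auto
  then obtain i j where "f i = f j" "i > j" unfolding inj_def by (metis linorder_neqE)
  then have "i - j \<in> S" "i - j > 0" using S_iff by auto
  then obtain l where l: "l > 0" "S = {i. l dvd i}" using int_subgroup_multiples[OF diff] by metis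
  have iff: "f i = f j \<longleftrightarrow> l dvd i - j" for i j using S_iff l by auto
  have "card (f ` {i. 1 dvd i}) = nat (l div 1)" by (rule card_image_multiples[OF iff]) (use l in auto)
  then show ?thesis using iff l by simp
qed

lemma alt_walk_card_pos:
  assumes "alt_walk f" shows "card (range f) > 0"
  using finite_subset[OF _ finite_V, of "range f"] alt_walk_in_V[OF assms] by (auto simp: card_gt_0_iff)

lemma alt_walk_card_even:
  assumes f: "alt_walk f" shows "even (card (range f))"
  using alt_walk_parity[OF f, of "int (card (range f))" 0] alt_walk_eq_iff[OF f] by simp

lemma alt_walk_card_ge:
  assumes f: "alt_walk f" shows "card (range f) \<ge> 4"
proof -
  have "\<not> int (card (range f)) dvd 2" using alt_walk_neq[OF f, of 0] alt_walk_eq_iff[OF f, of 1 "-1"]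
    by simp
  then have "card (range f) \<noteq> 2" by auto
  moreover obtain k where "card (range f) = 2 * k" using alt_walk_card_even[OF f] by auto
  ultimately have "k \<noteq> 0" "k \<noteq> 1" using alt_walk_card_pos[OF f] by auto
  then show ?thesis using \<open>card (range f) = 2 * k\<close> by linarith
qed

lemma alt_walk_card_eq:
  assumes f: "alt_walk f" and h: "alt_walk h" shows "card (range f) = card (range h)"
proof -
  obtain g where g: "g \<in> G" "\<And>i. g (f i) = h i" using alt_walk_transitive[OF f h] by auto
  have "range h = g ` range f" using g(2) by (metis (no_types, lifting) image_cong image_image)
  then show ?thesis
    using card_image[OF inj_on_subset[OF permutes_inj[OF G_permutes[OF g(1)]]]] by auto
qed

text \<open>Extend the arc to a path \<open>u\<close>, \<open>v\<close>, \<open>u'\<close>,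
  \<open>v'\<close> and take \<open>g\<close> in \<open>G\<close> carrying \<open>(u, v)\<close> to
  \<open>(u', v')\<close>. The translates of \<open>(u, v)\<close> by the powers of \<open>g\<close>
  make up the walk.\<close>

lemma alt_walk_exists:
  assumes "D u v"
  obtains f where "alt_walk f" "f 0 = u" "f 1 = v"
proof -
  have "\<exists>u'. u' \<noteq> u \<and> D u' v" using card_in[of v] D_V[OF assms] assms
    by (auto simp: card_2_iff set_eq_iff; metis)
  then obtain u' where u': "u' \<noteq> u" "D u' v" by auto
  have "\<exists>v'. v' \<noteq> v \<and> D u' v'" using card_out[of u'] D_V[OF u'(2)] u'(2)
    by (auto simp: card_2_iff set_eq_iff; metis)
  then obtain v' where v': "v' \<noteq> v" "D u' v'" by auto
  obtain g where g: "g \<in> G" "g u = u'" "g v = v'" using G_trans[OF assms v'(2)] by auto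
  have inj: "inj g" by (rule permutes_inj[OF G_permutes[OF g(1)]])
  have "permutation g" using G_permutes[OF g(1)] finite_V by (auto simp: permutation_permutes)
  then obtain N where N: "g ^^ N = id" "N > 0" using permutation_is_nilpotent by blast
  \<comment> \<open>\<open>g\<close> has finite order \<open>N\<close>, so exponents reduced modulo
    \<open>N\<close> serve negative integers too.\<close>
  define p where "p k = g ^^ nat (k mod int N)" for k :: int
  have p_Suc: "p (k + 1) x = g (p k x)" for k x
  proof -
    have "g ^^ (n mod N) = g ^^ n" for n
      using N by (metis (no_types, opaque_lifting) funpow_mod_eq id_apply ext)
    moreover have "nat ((k + 1) mod int N) = Suc (nat (k mod int N)) mod N"
    proof -
      have "int (Suc (nat (k mod int N)) mod N) = (k mod int N + 1) mod int N"
        using N by (simp add: zmod_int add.commute)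
      also have "\<dots> = (k + 1) mod int N" by (simp add: mod_simps)
      finally show ?thesis by simp
    qed
    ultimately have "p (k + 1) = g ^^ Suc (nat (k mod int N))" unfolding p_def by simp
    then show ?thesis by (simp add: p_def)
  qed
  have p_D: "D (p k x) (p k y)" if "D x y" for k x y
  proof -
    have "D ((g ^^ n) x) ((g ^^ n) y)" for n by (induction n) (use that G_D[OF g(1)] in auto)
    then show ?thesis by (simp add: p_def)
  qed
  have p_inj: "p k x = p k y \<longleftrightarrow> x = y" for k x y
    using inj_fn[OF inj] by (auto simp: p_def dest: injD)
  define f where "f i = p (i div 2) (if even i then u else v)" for i :: int
  have step: "p (k + 1) u = p k u'" "p (k + 1) v = p k v'" for k
  proof -
    have "p k (g x) = g (p k x)" for x by (simp add: p_def funpow_swap1)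
    then show "p (k + 1) u = p k u'" "p (k + 1) v = p k v'" using p_Suc g by metis+
  qed
  have f0: "f (2 * k) = p k u" "f (2 * k + 1) = p k v" for k by (auto simp: f_def)
  have f2: "f (2 * k + 2) = p k u'" "f (2 * k + 3) = p k v'" for k
    unfolding step[symmetric] f0[symmetric] by (simp_all add: algebra_simps)
  have "alt_walk f" unfolding alt_walk_def
  proof (intro conjI allI impI)
    fix i :: int assume "even i"
    then obtain k where k: "i = 2 * k" by auto
    show "D (f i) (f (i + 1))" using f0 p_D assms by (simp add: k)
    have "D (f (2 * (k - 1) + 2)) (f (2 * (k - 1) + 1))" unfolding f0 f2 by (rule p_D[OF u'(2)])
    then show "D (f i) (f (i - 1))" by (simp add: k algebra_simps)
  next
    fix i :: int
    show "f (i + 1) \<noteq> f (i - 1)"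
    proof (cases "even i")
      case True
      then obtain k where k: "i = 2 * k" by auto
      have "f (2 * (k - 1) + 3) \<noteq> f (2 * (k - 1) + 1)" unfolding f0 f2 p_inj by (rule v'(1))
      then show ?thesis by (simp add: k algebra_simps)
    next
      case False
      then obtain k where k: "i = 2 * k + 1" by (auto elim: oddE)
      have "f (2 * k + 2) \<noteq> f (2 * k)" unfolding f0 f2 p_inj by (rule u'(1))
      then show ?thesis by (simp add: k algebra_simps)
    qed
  qed
  moreover have "p 0 x = x" for x by (simp add: p_def)
  ultimately show thesis using that f0[of 0] by auto
qed

text \<open>Together with \<open>alt_walk_to\<close>: every vertex is a tail on one walk and a head
  on another. Crossings are normalised to \<open>f 0 = h 1\<close> accordingly.\<close>

lemma alt_walk_from:
  assumes "x \<in> V" obtains f where "alt_walk f" "f 0 = x"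
proof -
  have "{w. D x w} \<noteq> {}" using card_out[OF assms] by (auto simp del: Collect_empty_eq)
  then show thesis using alt_walk_exists that by blast
qed

lemma alt_walk_to:
  assumes "x \<in> V" obtains h where "alt_walk h" "h 1 = x"
proof -
  have "{w. D w x} \<noteq> {}" using card_in[OF assms] by (auto simp del: Collect_empty_eq)
  then show thesis using alt_walk_exists that by blast
qed

section \<open>Pairs of crossing alternating walks\<close>

text \<open>A meeting at equal parity would make \<open>h\<close> a shift or reflection of
  \<open>f\<close>; the crossing vertex would then have positions of both parities on
  \<open>f\<close>.\<close>

lemma alt_walk_crossing_parity:
  assumes f: "alt_walk f" and h: "alt_walk h" and cross: "f i = h j" "odd (i - j)"
    and eq: "f k = h l"
  shows "odd (k - l)"
proof
  assume even: "even (k - l)"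
  consider "h j = f (j + (k - l))" | "h j = f (k + l - j)"
    using alt_walk_meet[OF f h eq even] by blast
  then show False
  proof cases
    case 1
    then have "even (i - (j + (k - l)))" using alt_walk_parity[OF f] cross by metis
    then show False using even cross by presburger
  next
    case 2
    then have "even (i - (k + l - j))" using alt_walk_parity[OF f] cross by metis
    then show False using even cross by presburger
  qed
qed

text \<open>Common vertices have opposite parities on the two walks, for both pairs. As
  \<open>\<pi>\<close> keeps the parity of \<open>k\<close>, the image of \<open>h\<close> meets
  \<open>h'\<close> at equal parity, so the two agree up to parametrisation.\<close>

lemma alt_walk_crossing_range:
  assumes f: "alt_walk f" and h: "alt_walk h" and cross: "f 0 = h 1"
    and f': "alt_walk f'" and h': "alt_walk h'" and cross': "f' i = h' j" "odd (i - j)"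
    and g: "g \<in> G" and gf: "\<And>x. g (f x) = f' (\<pi> x)"
    and k: "f k \<in> range h" "f' (\<pi> k) \<in> range h'" and par: "even (\<pi> k - k)"
  shows "g ` range h = range h'"
proof -
  obtain l where l: "f k = h l" using k by auto
  obtain l' where l': "f' (\<pi> k) = h' l'" using k by auto
  have "odd (k - l)" by (rule alt_walk_crossing_parity[OF f h cross _ l]) simp
  moreover have "odd (\<pi> k - l')" by (rule alt_walk_crossing_parity[OF f' h' cross' l'])
  ultimately have "even (l - l')" using par by presburger
  moreover have "g (h l) = h' l'" using gf[of k] l l' by simp
  ultimately have "range (\<lambda>x. g (h x)) = range h'"
    using alt_walk_meet_range[OF alt_walk_G[OF h g] h'] by blast
  then show ?thesis by (simp add: image_image)
qed

text \<open>The rotation by \<open>i - j\<close> takes the common vertex \<open>f j\<close> to the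
  common vertex \<open>f i\<close>, hence maps \<open>range h\<close> to itself.\<close>

lemma crossing_rotate:
  assumes f: "alt_walk f" and h: "alt_walk h" and cross: "f 0 = h 1"
    and in_h: "f i \<in> range h" "f j \<in> range h" "f k \<in> range h" and par: "even (i - j)"
  shows "f (k + (i - j)) \<in> range h"
proof -
  obtain g where g: "g \<in> G" "\<And>x. g (f x) = f (x + (i - j))"
    using alt_walk_transitive[OF f alt_walk_shift[OF f par]] by auto
  have "g ` range h = range h"
    by (rule alt_walk_crossing_range[OF f h cross f h cross _ g, where k = j])
      (use in_h par in simp_all)
  then show ?thesis using g(2)[of k] in_h(3) by (metis imageI)
qed

lemma crossing_reflect:
  assumes f: "alt_walk f" and h: "alt_walk h" and cross: "f 0 = h 1"
    and in_h: "f j \<in> range h" "f k \<in> range h"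
  shows "f (2 * j - k) \<in> range h"
proof -
  obtain g where g: "g \<in> G" "\<And>x. g (f x) = f (2 * j - x)"
    using alt_walk_transitive[OF f alt_walk_reflect[OF f, of "2 * j"]] by auto
  have "g ` range h = range h"
    by (rule alt_walk_crossing_range[OF f h cross f h cross _ g, where k = j])
      (use in_h in simp_all)
  then show ?thesis using g(2)[of k] in_h(2) by (metis imageI)
qed

text \<open>Only even rotations are available, but one of \<open>i - j\<close>, \<open>j\<close>,
  \<open>i\<close> is always even: rotate \<open>f 0\<close> by \<open>i - j\<close>, or
  \<open>f i\<close> by \<open>- j\<close>, or \<open>f (- j)\<close> by \<open>i\<close>. A
  reflection about 0 puts \<open>f (- j)\<close> on \<open>h\<close>.\<close>

lemma crossing_diff:
  assumes f: "alt_walk f" and h: "alt_walk h" and cross: "f 0 = h 1"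
    and in_h: "f i \<in> range h" "f j \<in> range h"
  shows "f (i - j) \<in> range h"
proof -
  have zero: "f 0 \<in> range h" using cross by simp
  have minus: "f (- j) \<in> range h" using crossing_reflect[OF f h cross zero in_h(2)] by simp
  consider "even (i - j)" | "even j" | "even i" by fastforce
  then show ?thesis
  proof cases
    case 1
    then show ?thesis using crossing_rotate[OF f h cross in_h zero] by simp
  next
    case 2
    then show ?thesis using crossing_rotate[OF f h cross minus zero in_h(1)] by simp
  next
    case 3
    then show ?thesis using crossing_rotate[OF f h cross in_h(1) zero minus] by simp
  qed
qed

text \<open>By \<open>crossing_diff\<close>, the positions of common vertices are the multiples of
  some \<open>l\<close> dividing the period \<open>m\<close>, so \<open>a * l = m\<close>. For even
  \<open>a\<close>, \<open>m div 2\<close> is again a multiple of \<open>l\<close>.\<close>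

lemma crossing_card:
  assumes f: "alt_walk f" and h: "alt_walk h" and cross: "f 0 = h 1"
  defines "a \<equiv> card (range f \<inter> range h)"
  shows "a dvd card (range f)"
    and "even a \<Longrightarrow> f (int (card (range f) div 2)) \<in> range h"
proof -
  define m where "m = int (card (range f))"
  have m: "m > 0" using alt_walk_card_pos[OF f] by (simp add: m_def)
  have iff: "f i = f j \<longleftrightarrow> m dvd i - j" for i j unfolding m_def by (rule alt_walk_eq_iff[OF f])
  have "f m = h 1" using iff[of m 0] cross by simp
  then have "m \<in> {i. f i \<in> range h}" by simp
  then obtain l where l: "l > 0" "{i. f i \<in> range h} = {i. l dvd i}"
    using int_subgroup_multiples[of "{i. f i \<in> range h}" m] crossing_diff[OF f h cross] m by auto
  then have lm: "l dvd m" using \<open>m \<in> _\<close> by auto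
  have "range f \<inter> range h = f ` {i. f i \<in> range h}" by auto
  then have "a = nat (m div l)"
    unfolding a_def l(2) using card_image_multiples[OF iff m l(1) lm] by simp
  then have a: "int a * l = m" using lm l(1) m by (simp add: pos_imp_zdiv_nonneg_iff)
  then show "a dvd card (range f)" by (metis m_def dvd_triv_left of_nat_dvd_iff)
  assume "even a"
  then obtain b where "a = 2 * b" by auto
  then have "l dvd m div 2" using a by auto
  then show "f (int (card (range f) div 2)) \<in> range h"
    using l(2) by (auto simp: m_def zdiv_int)
qed

text \<open>The reflection of \<open>h\<close> about 1 fixes the common vertex, so it acts on
  \<open>f\<close> trivially or as the reflection about 0. Either way the antipode is fixed, and on
  \<open>h\<close> only the vertices at 1 and \<open>1 + r\<close> are fixed.\<close>

lemma crossing_antipode: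
  assumes f: "alt_walk f" and h: "alt_walk h" and cross: "f 0 = h 1"
    and r: "card (range f) = 2 * r" and in_h: "f (int r) \<in> range h"
  shows "f (int r) = h (1 + int r)"
proof -
  have r': "card (range h) = 2 * r" using r alt_walk_card_eq[OF f h] by simp
  have rpos: "r > 0" using alt_walk_card_pos[OF f] r by simp
  obtain q where q: "f (int r) = h q" using in_h by auto
  obtain g where g: "g \<in> G" "\<And>x. g (h x) = h (2 - x)"
    using alt_walk_transitive[OF h alt_walk_reflect[OF h, of 2]] by auto
  have neg: "f (- int r) = f (int r)" using alt_walk_eq_iff[OF f, of "- int r" "int r"] r by simp
  have "g (f 0) = f 0" using g(2)[of 1] cross by simp
  then have "(\<forall>x. g (f x) = f x) \<or> (\<forall>x. g (f x) = f (- x))"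
    using alt_walk_meet[OF f alt_walk_G[OF f g(1)], of 0 0] by auto
  then have "g (f (int r)) = f (int r)" using neg by metis
  then have "h (2 - q) = h q" using g(2) q by simp
  then have "2 * int r dvd 2 - q - q" using alt_walk_eq_iff[OF h] r' by simp
  then have "2 * int r dvd 2 * (1 - q)" by (simp add: algebra_simps)
  then have "int r dvd 1 - q" unfolding dvd_mult_cancel_left by simp
  then obtain t where t: "1 - q = int r * t" by auto
  \<comment> \<open>Even \<open>t\<close> would put the antipode at \<open>f 0\<close>, which
    \<open>r > 0\<close> rules out.\<close>
  show ?thesis
  proof (cases "even t")
    case True
    then have "2 * int r dvd 1 - q" using t by auto
    then have "h 1 = h q" using alt_walk_eq_iff[OF h, of 1 q] r' by simp
    then have "f (int r) = f 0" using q cross by simp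
    then have "2 * int r dvd int r" using alt_walk_eq_iff[OF f, of "int r" 0] r by simp
    then show ?thesis using rpos zdvd_imp_le[of "2 * int r" "int r"] by auto
  next
    case False
    then obtain s where "t = 2 * s + 1" by (auto elim: oddE)
    then have "1 + int r - q = 2 * int r * (s + 1)" using t by (simp add: algebra_simps)
    then have "h (1 + int r) = h q" using alt_walk_eq_iff[OF h, of "1 + int r" q] r' by simp
    then show ?thesis using q by simp
  qed
qed

text \<open>When the half-length \<open>r\<close> is odd, passing to the antipode moves tails to heads. The
  antipode of a vertex is the same on both alternating cycles through it, so the antipodal
  maps of the cycles fit together.\<close>

lemma antipodal_map:
  assumes f: "alt_walk f" and h: "alt_walk h" and cross: "f 0 = h 1"
    and r: "card (range f) = 2 * r" and "odd r" and in_h: "f (int r) \<in> range h"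
  obtains \<tau> where "\<And>x. x \<notin> V \<Longrightarrow> \<tau> x = x" "\<And>x. x \<in> V \<Longrightarrow> \<tau> x \<in> V" "\<And>x. \<tau> (\<tau> x) = x"
    "\<And>u v. D u v \<Longrightarrow> D (\<tau> v) (\<tau> u)"
proof -
  \<comment> \<open>The choice of walk is immaterial: walks with \<open>x\<close> at 0 agree up to
    direction, and positions \<open>r\<close> and \<open>- r\<close> coincide. Points outside
    \<open>V\<close> stay fixed, as \<open>aut\<close> demands.\<close>
  define \<tau> where "\<tau> x = (if x \<in> V then (SOME k. alt_walk k \<and> k 0 = x) (int r) else x)" for x
  have card_r: "card (range k) = 2 * r" if "alt_walk k" for k
    using alt_walk_card_eq[OF that f] r by simp
  have per: "k (x + 2 * int r) = k x" if "alt_walk k" for k x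
    using alt_walk_eq_iff[OF that] card_r[OF that] by simp
  have \<tau>_0: "\<tau> (k 0) = k (int r)" if k: "alt_walk k" for k
  proof -
    define k' where "k' = (SOME k'. alt_walk k' \<and> k' 0 = k 0)"
    have k': "alt_walk k' \<and> k' 0 = k 0" unfolding k'_def by (rule someI[of _ k]) (simp add: k)
    have "k (- int r) = k (int r)" using per[OF k, of "- int r"] by simp
    moreover have "k' (int r) = k (int r) \<or> k' (int r) = k (- int r)"
      using alt_walk_meet[of k k' 0 0] k k' by auto
    ultimately show ?thesis using alt_walk_in_V[OF k] by (simp add: \<tau>_def k'_def)
  qed
  have \<tau>_1: "\<tau> (k 1) = k (1 + int r)" if k: "alt_walk k" for k
  proof -
    \<comment> \<open>\<open>k 1\<close> is a head on \<open>k\<close>, while \<open>\<tau>\<close>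
      is computed on a walk \<open>f'\<close> where it is a tail. \<open>g\<close> carries the
      crossing of \<open>f\<close> and \<open>h\<close> to that of \<open>f'\<close> and
      \<open>k\<close>, so the antipode on \<open>f'\<close> lies on \<open>k\<close> and is the
      antipode there too.\<close>
    obtain f' where f': "alt_walk f'" "f' 0 = k 1" using alt_walk_from[OF alt_walk_in_V[OF k]] by metis
    obtain g where g: "g \<in> G" "\<And>x. g (f x) = f' x" using alt_walk_transitive[OF f f'(1)] by auto
    have "g ` range h = range k"
      by (rule alt_walk_crossing_range[OF f h cross f'(1) k f'(2) _ g, where k = 0])
        (use cross f'(2) in simp_all)
    then have "f' (int r) \<in> range k" using g(2)[of "int r"] in_h by (metis imageI)
    then show ?thesis
      using crossing_antipode[OF f'(1) k f'(2) card_r[OF f'(1)]] \<tau>_0[OF f'(1)] f'(2) by simp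
  qed
  have \<tau>_walk: "\<tau> (k i) = k (i + int r)" if k: "alt_walk k" for k i
  proof (cases "even i")
    case True
    then show ?thesis using \<tau>_0[OF alt_walk_shift[OF k True]] by (simp add: add.commute)
  next
    case False
    then show ?thesis using \<tau>_1[OF alt_walk_shift[OF k, of "i - 1"]] by (simp add: algebra_simps)
  qed
  show thesis
  proof
    show "\<tau> x = x" if "x \<notin> V" for x using that by (simp add: \<tau>_def)
    show "\<tau> x \<in> V" if "x \<in> V" for x
      using alt_walk_from[OF that] \<tau>_walk alt_walk_in_V by metis
    show "\<tau> (\<tau> x) = x" for x
    proof (cases "x \<in> V")
      case True
      then obtain k where k: "alt_walk k" "k 0 = x" by (rule alt_walk_from)
      show ?thesis using \<tau>_walk[OF k(1), of 0] \<tau>_walk[OF k(1), of "int r"] per[OF k(1), of 0] k(2) by simp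
    qed (simp add: \<tau>_def)
    show "D (\<tau> v) (\<tau> u)" if "D u v" for u v
    proof -
      obtain k where k: "alt_walk k" "k 0 = u" "k 1 = v" using alt_walk_exists[OF \<open>D u v\<close>] .
      \<comment> \<open>With \<open>r\<close> odd, positions 0 and 1 move to a head and a tail, in
        that order.\<close>
      have "D (k (int r + 1)) (k (int r))" using alt_walk_odd[OF k(1), of "int r"] \<open>odd r\<close> by simp
      then show ?thesis
        using \<tau>_walk[OF k(1), of 0] \<tau>_walk[OF k(1), of 1] k by (simp add: add.commute)
    qed
  qed
qed

end

section \<open>The orientation of a half-arc-transitive graph\<close>

locale half_arc_transitive_graph =
  fixes V :: "'a set" and E :: "'a \<Rightarrow> 'a \<Rightarrow> bool"
  assumes half_arc_transitive: "half_arc_transitive V E"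
begin

abbreviation "G \<equiv> aut V E"
abbreviation "D \<equiv> orient E G"

lemma E_V: "E u v \<Longrightarrow> u \<in> V \<and> v \<in> V"
  and E_sym: "E u v \<Longrightarrow> E v u"
  and finite_V: "finite V"
  using half_arc_transitive
  by (auto simp: half_arc_transitive_def G_half_arc_transitive_def simple_graph_def)

lemma aut_permutes: "g \<in> G \<Longrightarrow> g permutes V"
  by (auto simp: aut_def intro: bij_imp_permutes)

lemma aut_E:
  assumes "g \<in> G" shows "E (g u) (g v) \<longleftrightarrow> E u v"
proof -
  have "g x \<in> V \<longleftrightarrow> x \<in> V" for x using aut_permutes[OF assms] by (simp add: permutes_in_image)
  then show ?thesis using assms E_V unfolding aut_def by blast
qed

lemma autI: "g permutes V \<Longrightarrow> (\<And>u v. E (g u) (g v) \<longleftrightarrow> E u v) \<Longrightarrow> g \<in> G"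
  by (auto simp: aut_def permutes_imp_bij permutes_not_in)

lemma aut_comp: "g \<in> G \<Longrightarrow> h \<in> G \<Longrightarrow> g \<circ> h \<in> G"
  by (rule autI) (auto simp: aut_permutes aut_E permutes_compose)

lemma aut_inv:
  assumes "g \<in> G" shows "inv g \<in> G"
proof (rule autI)
  show "E (inv g u) (inv g v) \<longleftrightarrow> E u v" for u v
    using aut_E[OF assms, of "inv g u" "inv g v"] permutes_surj[OF aut_permutes[OF assms]]
    by (simp add: surj_f_inv_f)
qed (simp add: aut_permutes assms permutes_inv)

lemma orient_base:
  obtains a b where "E a b" "\<And>u v. D u v \<longleftrightarrow> (\<exists>g\<in>G. u = g a \<and> v = g b)"
proof -
  define p where "p = (SOME p. E (fst p) (snd p))"
  \<comment> \<open>A graph without edges would be arc-transitive vacuously.\<close>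
  have "\<exists>u v. E u v" using half_arc_transitive
    unfolding half_arc_transitive_def G_half_arc_transitive_def arc_transitive_on_def by blast
  then have "E (fst p) (snd p)" unfolding p_def by (metis (mono_tags, lifting) fst_conv snd_conv someI)
  moreover have "D u v \<longleftrightarrow> (\<exists>g\<in>G. u = g (fst p) \<and> v = g (snd p))" for u v
    unfolding orient_def p_def[symmetric] Let_def by auto
  ultimately show thesis using that by blast
qed

lemma orient_E: "D u v \<Longrightarrow> E u v"
  by (rule orient_base) (auto simp: aut_E)

lemma orient_aut: "g \<in> G \<Longrightarrow> D u v \<Longrightarrow> D (g u) (g v)"
  by (rule orient_base) (metis aut_comp comp_apply)

lemma orient_trans:
  assumes "D u v" "D x y" shows "\<exists>g\<in>G. g u = x \<and> g v = y"
proof -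
  obtain a b where ab: "\<And>u v. D u v \<longleftrightarrow> (\<exists>g\<in>G. u = g a \<and> v = g b)" using orient_base by metis
  obtain g h where g: "g \<in> G" "u = g a" "v = g b" and h: "h \<in> G" "x = h a" "y = h b"
    using assms unfolding ab by auto
  have "inv g (g z) = z" for z using permutes_inj[OF aut_permutes[OF g(1)]] by simp
  then show ?thesis using aut_comp[OF h(1) aut_inv[OF g(1)]] g h by (intro bexI[of _ "h \<circ> inv g"]) auto
qed

lemma E_orient:
  assumes "E u v" shows "D u v \<or> D v u"
proof -
  obtain a b where ab: "E a b" "\<And>u v. D u v \<longleftrightarrow> (\<exists>g\<in>G. u = g a \<and> v = g b)"
    by (rule orient_base) blast
  have "edge_transitive_on E G"
    using half_arc_transitive by (simp add: half_arc_transitive_def G_half_arc_transitive_def)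
  then obtain g where "g \<in> G" "{g a, g b} = {u, v}"
    using ab(1) assms unfolding edge_transitive_on_def by blast
  then show ?thesis unfolding ab(2) doubleton_eq_iff by auto
qed

text \<open>If the orbit contained the reverse of one of its arcs, it would contain both directions
  of every edge, and the graph would be arc-transitive.\<close>

lemma orient_asym:
  assumes "D u v" shows "\<not> D v u"
proof
  assume "D v u"
  have all: "D x y" if "E x y" for x y
  proof (cases "D x y")
    case False
    then have "D y x" using E_orient[OF that] by simp
    then obtain g where g: "g \<in> G" "g u = y" "g v = x" using orient_trans[OF assms] by blast
    show ?thesis using orient_aut[OF g(1) \<open>D v u\<close>] g by simp
  qed
  have "arc_transitive_on E G"
    unfolding arc_transitive_on_def using all orient_trans by blast
  then show False
    using half_arc_transitive by (simp add: half_arc_transitive_def G_half_arc_transitive_def)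
qed

lemma orient_V: "D u v \<Longrightarrow> u \<in> V \<and> v \<in> V"
  using orient_E E_V by blast

lemma orient_iff: "g \<in> G \<Longrightarrow> D (g u) (g v) \<longleftrightarrow> D u v"
  using orient_aut[of g u v] orient_aut[of g v u] aut_E[of g u v] orient_E[of "g u" "g v"]
    E_orient[of u v] orient_asym[of "g u" "g v"] by blast

text \<open>Out-valency is constant by vertex-transitivity, and in- and out-valency add up to 4.
  Counting arcs by tails and by heads makes the two equal.\<close>

lemma orient_degrees:
  assumes "v \<in> V" shows "card {w. D v w} = 2" "card {w. D w v} = 2"
proof -
  have fin: "finite {w. D x w}" "finite {w. D w x}" for x
    by (rule finite_subset[OF _ finite_V]; use orient_V in blast)+
  have sum4: "card {w. D x w} + card {w. D w x} = 4" if "x \<in> V" for x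
  proof -
    have "{w. D x w} \<union> {w. D w x} = {w \<in> V. E x w}"
      using orient_E E_sym E_orient E_V by blast
    moreover have "{w. D x w} \<inter> {w. D w x} = {}" using orient_asym by blast
    moreover have "card {w \<in> V. E x w} = 4"
      using half_arc_transitive that
      by (auto simp: half_arc_transitive_def G_half_arc_transitive_def tetravalent_def)
    ultimately show ?thesis using card_Un_disjoint[OF fin, of x x] by simp
  qed
  have const: "card {w. D x w} = card {w. D v w}" if "x \<in> V" for x
  proof -
    have "vertex_transitive_on V G"
      using half_arc_transitive by (simp add: half_arc_transitive_def G_half_arc_transitive_def)
    then obtain g where g: "g \<in> G" "g v = x"
      using \<open>x \<in> V\<close> assms unfolding vertex_transitive_on_def by blast
    have "{w. D x w} = g ` {w. D v w}"
    proof
      show "{w. D x w} \<subseteq> g ` {w. D v w}"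
      proof
        fix w assume "w \<in> {w. D x w}"
        moreover obtain z where "w = g z" using permutes_surj[OF aut_permutes[OF g(1)]] by auto
        ultimately show "w \<in> g ` {w. D v w}" using orient_iff[OF g(1)] g(2) by auto
      qed
    qed (use orient_aut[OF g(1)] g(2) in auto)
    then show ?thesis
      using card_image[OF inj_on_subset[OF permutes_inj[OF aut_permutes[OF g(1)]]]] by auto
  qed
  have "(\<Sum>x\<in>V. card {w. D x w}) = (\<Sum>x\<in>V. card {w. D w x})"
  proof -
    have "(\<Sum>x\<in>V. card {w \<in> V. D x w}) = (\<Sum>x\<in>V. card {w \<in> V. D w x})"
      using sum_multicount_gen[of V V "\<lambda>x y. D x y" "\<lambda>y. card {w \<in> V. D w y}"] finite_V by simp
    moreover have "{w \<in> V. D x w} = {w. D x w}" "{w \<in> V. D w x} = {w. D w x}" for x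
      using orient_V by blast+
    ultimately show ?thesis by simp
  qed
  also have "\<dots> = (\<Sum>x\<in>V. 4 - card {w. D v w})"
    by (rule sum.cong) (use sum4 const in fastforce)+
  also have "(\<Sum>x\<in>V. card {w. D x w}) = (\<Sum>x\<in>V. card {w. D v w})"
    by (rule sum.cong) (use const in auto)
  finally have "card {w. D v w} = 4 - card {w. D v w}" using assms finite_V by auto
  then show "card {w. D v w} = 2" "card {w. D w v} = 2" using sum4[OF assms] by linarith+
qed

sublocale arc_transitive_digraph V D G
  by unfold_locales
    (use finite_V orient_V orient_asym orient_degrees aut_permutes orient_aut orient_trans in auto)

text \<open>For odd \<open>r\<close> the antipodal map reverses all arcs of \<open>D\<close>. It is
  thus an automorphism of the undirected graph, yet automorphisms preserve \<open>D\<close>.\<close>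

lemma antipodal_crossing_even:
  assumes f: "alt_walk f" and h: "alt_walk h" and cross: "f 0 = h 1"
    and r: "card (range f) = 2 * r" and in_h: "f (int r) \<in> range h"
  shows "even r"
proof (rule ccontr)
  assume "odd r"
  obtain \<tau> where \<tau>: "\<And>x. x \<notin> V \<Longrightarrow> \<tau> x = x" "\<And>x. x \<in> V \<Longrightarrow> \<tau> x \<in> V" "\<And>x. \<tau> (\<tau> x) = x"
    and rev: "\<And>u v. D u v \<Longrightarrow> D (\<tau> v) (\<tau> u)"
    using antipodal_map[OF f h cross r \<open>odd r\<close> in_h] by metis
  have E\<tau>: "E (\<tau> u) (\<tau> v)" if "E u v" for u v
    using E_orient[OF that] rev orient_E E_sym by blast
  have "\<tau> \<in> G"
  proof (rule autI)
    have "bij_betw \<tau> V V" by (rule bij_betw_byWitness[where f' = \<tau>]) (use \<tau> in auto)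
    then show "\<tau> permutes V" using \<tau>(1) by (rule bij_imp_permutes)
    show "E (\<tau> u) (\<tau> v) \<longleftrightarrow> E u v" for u v using E\<tau>[of u v] E\<tau>[of "\<tau> u" "\<tau> v"] \<tau>(3) by auto
  qed
  moreover have "D (f 0) (f 1)" using alt_walk_even[OF f, of 0] by simp
  ultimately show False using orient_aut rev orient_asym by blast
qed

section \<open>From alternating walks to alternating cycles, radius and attachment number\<close>

lemma alt_walk_meet_edges:
  assumes "alt_walk f" "alt_walk h" "f i = h j" "even (i - j)"
  shows "walk_edges f = walk_edges h"
  using alt_walk_meet[OF assms]
proof
  assume eq: "\<forall>x. h x = f (x + (i - j))"
  have "walk_edges h = walk_edges (\<lambda>x. f (x + (i - j)))" using eq by (simp add: walk_edges_def)
  then show ?thesis by (simp add: walk_edges_shift)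
next
  assume eq: "\<forall>x. h x = f (i + j - x)"
  have "walk_edges h = walk_edges (\<lambda>x. f (i + j - x))" using eq by (simp add: walk_edges_def)
  then show ?thesis by (simp add: walk_edges_reflect)
qed

text \<open>Tails and heads alternate along the list, so a shift by at most one puts the tails at
  even positions.\<close>

lemma alternating_cycle_walk:
  assumes "alternating_cycle E G c"
  obtains f where "alt_walk f" "range f = set c" "walk_edges f = cycle_edges c"
proof -
  define F where "F = cyclic_nth c"
  have c: "distinct c" "length c \<ge> 3"
    and kind: "\<And>i. (D (F (i - 1)) (F i) \<and> D (F (i + 1)) (F i)) \<or> (D (F i) (F (i - 1)) \<and> D (F i) (F (i + 1)))"
    using assms unfolding alternating_cycle_iff F_def by blast+
  have "c \<noteq> []" using c by auto
  define T where "T i \<longleftrightarrow> D (F i) (F (i + 1))" for i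
  have T_Suc: "T (i + 1) \<longleftrightarrow> \<not> T i" for i
    using kind[of "i + 1"] orient_asym unfolding T_def by auto
  have T: "T i \<longleftrightarrow> (even i \<longleftrightarrow> T 0)" for i
  proof (induction i rule: int_induct[where k = 0])
    case (step1 i)
    then show ?case using T_Suc[of i] by auto
  next
    case (step2 i)
    then show ?case using T_Suc[of "i - 1"] by auto
  qed simp
  have prev: "D (F i) (F (i - 1))" if "T i" for i
    using that kind[of i] orient_asym unfolding T_def by auto
  have neq: "F (i + 1) \<noteq> F (i - 1)" for i
  proof
    assume "F (i + 1) = F (i - 1)"
    then have "int (length c) dvd i + 1 - (i - 1)" unfolding F_def cyclic_nth_eq_iff[OF c(1) \<open>c \<noteq> []\<close>] .
    then have "int (length c) dvd 2" by simp
    then show False using zdvd_imp_le[of "int (length c)" 2] c(2) by simp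
  qed
  show thesis
  proof (cases "T 0")
    case True
    then have "alt_walk F" using T prev neq unfolding alt_walk_def T_def by blast
    then show thesis using that[of F] \<open>c \<noteq> []\<close> by (simp add: F_def range_cyclic_nth walk_edges_cyclic_nth)
  next
    case False
    have "alt_walk (\<lambda>i. F (i + 1))" unfolding alt_walk_def
    proof (intro conjI allI impI)
      fix i :: int assume "even i"
      then have "T (i + 1)" using T[of "i + 1"] False by simp
      then show "D (F (i + 1)) (F (i + 1 + 1))" "D (F (i + 1)) (F (i - 1 + 1))"
        using prev[of "i + 1"] by (simp_all add: T_def)
    next
      show "F (i + 1 + 1) \<noteq> F (i - 1 + 1)" for i using neq[of "i + 1"] by simp
    qed
    moreover have "range (\<lambda>i. F (i + 1)) = range F"
    proof -
      have "surj (\<lambda>i::int. i + 1)" by (rule surjI[where f = "\<lambda>i. i - 1"]) simp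
      then show ?thesis using image_image[of F "\<lambda>i. i + 1" UNIV] by simp
    qed
    ultimately show thesis using that[of "\<lambda>i. F (i + 1)"] \<open>c \<noteq> []\<close>
      by (simp add: F_def range_cyclic_nth walk_edges_cyclic_nth walk_edges_shift)
  qed
qed

text \<open>One period of the walk lists the cycle: no vertex repeats within it, and it has at least
  four.\<close>

lemma alt_walk_cycle:
  assumes f: "alt_walk f"
  obtains c where "alternating_cycle E G c" "set c = range f" "cycle_edges c = walk_edges f"
proof -
  define m where "m = card (range f)"
  have m: "m \<ge> 4" unfolding m_def by (rule alt_walk_card_ge[OF f])
  define c where "c = map (\<lambda>i. f (int i)) [0..<m]"
  have len: "length c = m" by (simp add: c_def)
  have iff: "f i = f j \<longleftrightarrow> int m dvd i - j" for i j unfolding m_def by (rule alt_walk_eq_iff[OF f])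
  have "c \<noteq> []" using len m by auto
  have nth: "cyclic_nth c = f"
  proof
    fix i
    have "nat (i mod int m) < m" using m by (simp add: nat_less_iff)
    then have "cyclic_nth c i = f (i mod int m)" using m by (simp add: cyclic_nth_def len) (simp add: c_def)
    also have "\<dots> = f i" unfolding iff by (metis mod_eq_dvd_iff mod_mod_trivial)
    finally show "cyclic_nth c i = f i" .
  qed
  have "distinct c" unfolding c_def
  proof (simp add: distinct_map, rule inj_onI)
    fix x y assume xy: "x \<in> {0..<m}" "y \<in> {0..<m}" "f (int x) = f (int y)"
    then have "int x mod int m = int y mod int m" unfolding iff mod_eq_dvd_iff by simp
    then show "x = y" using xy by simp
  qed
  moreover have "E (f i) (f (i + 1))" for i
    using alt_walk_even[OF f, of i] alt_walk_odd[OF f, of i] orient_E E_sym by blast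
  ultimately have "alternating_cycle E G c"
    unfolding alternating_cycle_iff nth using len m alt_walk_even[OF f] alt_walk_odd[OF f] by auto
  then show thesis
    using that range_cyclic_nth[OF \<open>c \<noteq> []\<close>] walk_edges_cyclic_nth[OF \<open>c \<noteq> []\<close>] nth by simp
qed

lemma crossing_walks_exist: obtains f h where "alt_walk f" "alt_walk h" "f 0 = h 1"
proof -
  obtain a b where "E a b" by (rule orient_base)
  then have "a \<in> V" using E_V by blast
  then show thesis using alt_walk_from[of a] alt_walk_to[of a] that by metis
qed

text \<open>All alternating walks have equally many vertices, so the choice in
  \<open>G_radius\<close> has no effect; the number is even, so halving loses nothing.\<close>

lemma alt_walk_radius:
  assumes f: "alt_walk f" shows "card (range f) = 2 * rad V E"
proof -
  define c where "c = (SOME c. alternating_cycle E G c)"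
  have c: "alternating_cycle E G c"
    unfolding c_def using alt_walk_cycle[OF f] by (metis someI_ex)
  then obtain h where h: "alt_walk h" "range h = set c" by (rule alternating_cycle_walk)
  have "card (range f) = length c"
    using alt_walk_card_eq[OF f h(1)] h(2) c by (simp add: alternating_cycle_iff distinct_card)
  moreover have "rad V E = length c div 2" by (simp add: rad_def G_radius_def c_def)
  ultimately show ?thesis using alt_walk_card_even[OF f] by simp
qed

text \<open>\<open>D\<close> orients a common edge in one way only, so \<open>f 0\<close> would have
  an even position on \<open>h\<close> besides position 1.\<close>

lemma crossing_edges_neq:
  assumes f: "alt_walk f" and h: "alt_walk h" and cross: "f 0 = h 1"
  shows "walk_edges f \<noteq> walk_edges h"
proof
  assume "walk_edges f = walk_edges h"
  moreover have "{f 0, f 1} \<in> walk_edges f"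
    unfolding walk_edges_def by (rule range_eqI[of _ _ 0]) simp
  ultimately obtain j where j: "{f 0, f 1} = {h j, h (j + 1)}" unfolding walk_edges_def by auto
  have D: "D (f 0) (f 1)" using alt_walk_even[OF f, of 0] by simp
  consider "f 0 = h j" "f 1 = h (j + 1)" | "f 0 = h (j + 1)" "f 1 = h j"
    using j unfolding doubleton_eq_iff by blast
  then show False
  proof cases
    case 1
    then have "even j" using alt_walk_odd[OF h, of j] D orient_asym by auto
    then show False using alt_walk_parity[OF h, of j 1] 1 cross by simp
  next
    case 2
    then have "odd j" using alt_walk_even[OF h, of j] D orient_asym by auto
    then show False using alt_walk_parity[OF h, of "j + 1" 1] 2 cross by simp
  qed
qed

text \<open>The chosen cycles differ, so at a common vertex their parities differ. Swapping the
  walks if necessary and shifting both by even amounts moves the crossing to positions 0 and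
  1.\<close>

lemma attachment_walks:
  obtains f h where "alt_walk f" "alt_walk h" "f 0 = h 1" "att V E = card (range f \<inter> range h)"
proof -
  note found = that
  define P where "P cc \<longleftrightarrow> alternating_cycle E G (fst cc) \<and> alternating_cycle E G (snd cc)
    \<and> cycle_edges (fst cc) \<noteq> cycle_edges (snd cc) \<and> set (fst cc) \<inter> set (snd cc) \<noteq> {}" for cc
  define cc where "cc = (SOME cc. P cc)"
  have att: "att V E = card (set (fst cc) \<inter> set (snd cc))"
    by (simp add: att_def G_attachment_def cc_def P_def Let_def)
  have "\<exists>cc. P cc"
  proof -
    obtain f h where fh: "alt_walk f" "alt_walk h" "f 0 = h 1" by (rule crossing_walks_exist)
    obtain c where c: "alternating_cycle E G c" "set c = range f" "cycle_edges c = walk_edges f"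
      by (rule alt_walk_cycle[OF fh(1)])
    obtain d where d: "alternating_cycle E G d" "set d = range h" "cycle_edges d = walk_edges h"
      by (rule alt_walk_cycle[OF fh(2)])
    have "f 0 \<in> range f" "f 0 \<in> range h" by (rule rangeI) (simp add: fh(3))
    then have "f 0 \<in> set c \<inter> set d" using c(2) d(2) by simp
    then have "set c \<inter> set d \<noteq> {}" by blast
    then have "P (c, d)" using c(1,3) d(1,3) crossing_edges_neq[OF fh] by (simp add: P_def)
    then show ?thesis ..
  qed
  then have "P cc" unfolding cc_def by (rule someI_ex)
  then have cc: "alternating_cycle E G (fst cc)" "alternating_cycle E G (snd cc)"
    "cycle_edges (fst cc) \<noteq> cycle_edges (snd cc)" "set (fst cc) \<inter> set (snd cc) \<noteq> {}"
    by (simp_all add: P_def)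
  obtain f where f: "alt_walk f" "range f = set (fst cc)" "walk_edges f = cycle_edges (fst cc)"
    by (rule alternating_cycle_walk[OF cc(1)])
  obtain h where h: "alt_walk h" "range h = set (snd cc)" "walk_edges h = cycle_edges (snd cc)"
    by (rule alternating_cycle_walk[OF cc(2)])
  obtain i j where ij: "f i = h j" using cc(4) unfolding f(2)[symmetric] h(2)[symmetric] by auto
  have odd: "odd (i - j)" using alt_walk_meet_edges[OF f(1) h(1) ij] f(3) h(3) cc(3) by auto
  have *: thesis if fh: "alt_walk f" "alt_walk h" "f i = h j" "even i" "odd j"
    "att V E = card (range f \<inter> range h)" for f h i j
  proof -
    have f': "alt_walk (\<lambda>x. f (x + i))" and h': "alt_walk (\<lambda>x. h (x + (j - 1)))"
      using fh by (auto intro: alt_walk_shift)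
    have "range (\<lambda>x. f (x + i)) = range f"
      by (rule alt_walk_meet_range[OF f' fh(1), of 0 i]) (use fh in simp_all)
    moreover have "range (\<lambda>x. h (x + (j - 1))) = range h"
      by (rule alt_walk_meet_range[OF h' fh(2), of 1 j]) (use fh in simp_all)
    ultimately show thesis using found[OF f' h'] fh by simp
  qed
  show thesis
  proof (cases "even i")
    case True
    then show thesis using *[OF f(1) h(1) ij] odd att f(2) h(2) by simp
  next
    case False
    then show thesis using *[OF h(1) f(1) ij[symmetric]] odd att f(2) h(2) by (simp add: Int_commute)
  qed
qed

end

theorem theorem1p2:
  fixes V :: "'a set" and E :: "'a \<Rightarrow> 'a \<Rightarrow> bool"
  assumes "half_arc_transitive V E"
  shows "(odd (rad V E) \<longrightarrow> att V E dvd rad V E)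
       \<and> (\<not> (4 dvd att V E) \<longrightarrow> att V E dvd rad V E)"
proof -
  interpret half_arc_transitive_graph V E by unfold_locales (rule assms)
  obtain f h where fh: "alt_walk f" "alt_walk h" "f 0 = h 1"
    and att: "att V E = card (range f \<inter> range h)" by (rule attachment_walks)
  have rad: "card (range f) = 2 * rad V E" by (rule alt_walk_radius[OF fh(1)])
  have dvd: "att V E dvd 2 * rad V E" using crossing_card(1)[OF fh] att rad by simp
  have even: "even (rad V E)" if "even (att V E)"
    using antipodal_crossing_even[OF fh rad] crossing_card(2)[OF fh] that att rad by simp
  have odd_att: "att V E dvd rad V E" if "odd (att V E)"
    using dvd that by (simp add: coprime_dvd_mult_right_iff)
  \<comment> \<open>Here the attachment number is \<open>2 * b\<close> with \<open>b\<close> odd and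
    the radius is \<open>2 * q\<close>, so \<open>b dvd 2 * q\<close> improves to
    \<open>b dvd q\<close>.\<close>
  have "att V E dvd rad V E" if a: "even (att V E)" "\<not> 4 dvd att V E"
  proof -
    obtain b where b: "att V E = 2 * b" using a by auto
    then have "odd b" using a by (auto elim: evenE)
    moreover obtain q where q: "rad V E = 2 * q" using even[OF a(1)] by auto
    moreover have "b dvd 2 * q" using dvd b q by simp
    ultimately have "b dvd q" by (simp add: coprime_dvd_mult_right_iff)
    then show ?thesis using b q by simp
  qed
  \<comment> \<open>An odd radius forces an odd attachment number, by contraposition of
    \<open>even\<close>.\<close>
  then show ?thesis using even odd_att by blast
qed

end
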